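(* Let $n\ge 1$ and let $X_1,\dots,X_n$ be i.i.d. with distribution $P_0$ on $\mathbb{X}$. Let $\{P_\theta : \theta\in\Theta\}$ be a statistical model (not necessarily containing $P_0$), let $\pi$ be a prior probability distribution on $\Theta$ and let $\beta>0$. Let $\theta^*\in\arg\min_{\theta\in\Theta}\mathbb{D}_k(P_\theta,P_0)$ and $\mathcal{B}_n=\{\theta\in\Theta : \mathbb{D}_k(P_\theta,P_{\theta^*})\le n^{-1/2}\}$. Assume that the prior mass condition $$\pi(\mathcal{B}_n)\ge e^{-\beta/n}$$ holds. Then the MMD-Bayes pseudo-posterior $\pi_n^\beta$ satisfies $$\mathbb{E}\left[\int \mathbb{D}_k^2(P_\theta,P_0)\,\pi_n^\beta(d\theta)\right]\le 8\inf_{\theta\in\Theta}\mathbb{D}_k^2(P_\theta,P_0)+\frac{16}{n},$$ where the expectation is with respect to the sample $X_1,\dots,X_n$.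
   Context: $(\mathbb{X},\mathcal{X})$ is a measurable space, and $k:\mathbb{X}\times\mathbb{X}\to\mathbb{R}$ is a (measurable, symmetric) positive definite kernel with $|k|\le 1$, which is integrally strictly positive definite (i.e. $\iint k\,d\mu\,d\mu>0$ for every nonzero finite signed measure $\mu$ on $\mathbb{X}$). $\mathcal{H}_k$ is the associated reproducing kernel Hilbert space, with $f(x)=\langle f,k(x,\cdot)\rangle_{\mathcal{H}_k}$ for $f\in\mathcal{H}_k$, $x\in\mathbb{X}$. For a probability distribution $P$ on $\mathbb{X}$ the kernel mean embedding is $\mu_P=\mathbb{E}_{X\sim P}[k(X,\cdot)]\in\mathcal{H}_k$, and the Maximum Mean Discrepancy is $\mathbb{D}_k(P,Q)=\|\mu_P-\mu_Q\|_{\mathcal{H}_k}$. $P_0$ is a probability distribution on $\mathbb{X}$ (the data-generating distribution). The parameter space $\Theta$ is equipped with a sigma-algebra, and $\{P_\theta:\theta\in\Theta\}$ is a family of probability distributions on $\mathbb{X}$, with $\theta\mapsto P_\theta$ measurable so that all integrals below make sense. The empirical measure is $\hat P_n=\frac1n\sum_{i=1}^n\delta_{X_i}$. The MMD-Bayes pseudo-posterior with prior $\pi$ and temperature parameter $\beta>0$ is the (random) probability distribution on $\Theta$ defined by $$\pi_n^\beta(d\theta)\propto\exp\left(-\beta\,\mathbb{D}_k^2(P_\theta,\hat P_n)\right)\pi(d\theta).$$ A minimizer $\theta^*$ of $\theta\mapsto\mathbb{D}_k(P_\theta,P_0)$ is assumed to exist. *)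

theory Defs
  imports "HOL-Probability.Probability"
begin

definition pos_def_kernel :: "'x set \<Rightarrow> ('x \<Rightarrow> 'x \<Rightarrow> real) \<Rightarrow> bool" where
  "pos_def_kernel S k \<longleftrightarrow>
     (\<forall>x\<in>S. \<forall>y\<in>S. k x y = k y x) \<and>
     (\<forall>F c. finite F \<and> F \<subseteq> S \<longrightarrow> 0 \<le> (\<Sum>x\<in>F. \<Sum>y\<in>F. c x * c y * k x y))"

definition finite_signed_measure :: "'x measure \<Rightarrow> ('x set \<Rightarrow> real) \<Rightarrow> bool" where
  "finite_signed_measure M \<mu> \<longleftrightarrow>
     \<mu> {} = 0 \<and>
     (\<forall>A :: nat \<Rightarrow> 'x set. range A \<subseteq> sets M \<and> disjoint_family A \<longrightarrow>
        (\<lambda>i. \<mu> (A i)) sums \<mu> (\<Union>i. A i))"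

text \<open>
  The positive part of the Jordan decomposition of a finite signed measure. The negative part is
  the positive part of the negated signed measure. Where \<open>\<mu> B\<close> is negative, \<open>ennreal\<close> truncates it
  to 0; this does not change the supremum, since the empty set is admitted.
\<close>

definition jordan_pos :: "'x measure \<Rightarrow> ('x set \<Rightarrow> real) \<Rightarrow> 'x measure" where
  "jordan_pos M \<mu> =
     measure_of (space M) (sets M) (\<lambda>A. SUP B\<in>{B \<in> sets M. B \<subseteq> A}. ennreal (\<mu> B))"

definition signed_integral :: "'x measure \<Rightarrow> ('x set \<Rightarrow> real) \<Rightarrow> ('x \<Rightarrow> real) \<Rightarrow> real" where
  "signed_integral M \<mu> f =
     (\<integral>x. f x \<partial>jordan_pos M \<mu>) - (\<integral>x. f x \<partial>jordan_pos M (\<lambda>A. - \<mu> A))"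

definition integrally_strictly_pos_def :: "'x measure \<Rightarrow> ('x \<Rightarrow> 'x \<Rightarrow> real) \<Rightarrow> bool" where
  "integrally_strictly_pos_def M k \<longleftrightarrow>
     (\<forall>\<mu>. finite_signed_measure M \<mu> \<and> (\<exists>A\<in>sets M. \<mu> A \<noteq> 0) \<longrightarrow>
        0 < signed_integral M \<mu> (\<lambda>x. signed_integral M \<mu> (\<lambda>y. k x y)))"

text \<open>
  Real functions on a carrier set \<open>S\<close> are represented by total functions vanishing outside \<open>S\<close>, so
  that equal functions on \<open>S\<close> have a unique representative.
\<close>

definition kernel_section :: "'x set \<Rightarrow> ('x \<Rightarrow> 'x \<Rightarrow> real) \<Rightarrow> 'x \<Rightarrow> 'x \<Rightarrow> real" where
  "kernel_section S k x = (\<lambda>y. if y \<in> S then k x y else 0)"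

text \<open>
  \<open>H\<close> with inner product \<open>ip\<close> is the reproducing kernel Hilbert space of \<open>k\<close> on \<open>S\<close>; by the
  Moore--Aronszajn theorem, \<open>H\<close> and the restriction of \<open>ip\<close> to \<open>H\<close> exist and are uniquely
  determined by a positive definite kernel \<open>k\<close>.
\<close>

locale rkhs =
  fixes S :: "'x set"
    and k :: "'x \<Rightarrow> 'x \<Rightarrow> real"
    and H :: "('x \<Rightarrow> real) set"
    and ip :: "('x \<Rightarrow> real) \<Rightarrow> ('x \<Rightarrow> real) \<Rightarrow> real"
  assumes vanishes_outside: "\<And>f x. f \<in> H \<Longrightarrow> x \<notin> S \<Longrightarrow> f x = 0"
    and zero_mem: "(\<lambda>_. 0) \<in> H"
    and add_mem: "\<And>f g. f \<in> H \<Longrightarrow> g \<in> H \<Longrightarrow> (\<lambda>x. f x + g x) \<in> H"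
    and scale_mem: "\<And>c f. f \<in> H \<Longrightarrow> (\<lambda>x. c * f x) \<in> H"
    and ip_commute: "\<And>f g. f \<in> H \<Longrightarrow> g \<in> H \<Longrightarrow> ip f g = ip g f"
    and ip_add_left:
      "\<And>f g h. f \<in> H \<Longrightarrow> g \<in> H \<Longrightarrow> h \<in> H \<Longrightarrow> ip (\<lambda>x. f x + g x) h = ip f h + ip g h"
    and ip_scale_left: "\<And>c f g. f \<in> H \<Longrightarrow> g \<in> H \<Longrightarrow> ip (\<lambda>x. c * f x) g = c * ip f g"
    and ip_nonneg: "\<And>f. f \<in> H \<Longrightarrow> 0 \<le> ip f f"
    and ip_definite: "\<And>f. f \<in> H \<Longrightarrow> ip f f = 0 \<Longrightarrow> f = (\<lambda>_. 0)"
    and complete: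
      "\<And>u :: nat \<Rightarrow> 'x \<Rightarrow> real. (\<And>i. u i \<in> H) \<Longrightarrow>
         (\<And>e. 0 < e \<Longrightarrow> \<exists>N. \<forall>i\<ge>N. \<forall>j\<ge>N.
            sqrt (ip (\<lambda>x. u i x - u j x) (\<lambda>x. u i x - u j x)) < e) \<Longrightarrow>
         \<exists>f\<in>H. (\<lambda>i. sqrt (ip (\<lambda>x. u i x - f x) (\<lambda>x. u i x - f x))) \<longlonglongrightarrow> 0"
    and section_mem: "\<And>x. x \<in> S \<Longrightarrow> kernel_section S k x \<in> H"
    and reproducing: "\<And>f x. f \<in> H \<Longrightarrow> x \<in> S \<Longrightarrow> f x = ip f (kernel_section S k x)"

text \<open>
  The \<open>H\<close>-valued expectation of \<open>k(X, \<cdot>)\<close> for \<open>X \<sim> P\<close>. The Bochner integral of the library is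
  confined to second-countable Banach spaces given as types, whereas \<open>H\<close> is a set of functions and
  need not be separable; hence the weak integral, the unique \<open>g \<in> H\<close> with
  \<open>\<langle>f, g\<rangle> = E \<langle>f, k(X, \<cdot>)\<rangle>\<close> for all \<open>f \<in> H\<close>.
\<close>

definition mean_embedding ::
    "'x set \<Rightarrow> ('x \<Rightarrow> 'x \<Rightarrow> real) \<Rightarrow> ('x \<Rightarrow> real) set \<Rightarrow>
     (('x \<Rightarrow> real) \<Rightarrow> ('x \<Rightarrow> real) \<Rightarrow> real) \<Rightarrow> 'x measure \<Rightarrow> 'x \<Rightarrow> real" where
  "mean_embedding S k H ip P =
     (THE g. g \<in> H \<and>
        (\<forall>f\<in>H. integrable P (\<lambda>x. ip f (kernel_section S k x)) \<and>
               ip f g = (\<integral>x. ip f (kernel_section S k x) \<partial>P)))"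

definition mmd ::
    "'x set \<Rightarrow> ('x \<Rightarrow> 'x \<Rightarrow> real) \<Rightarrow> ('x \<Rightarrow> real) set \<Rightarrow>
     (('x \<Rightarrow> real) \<Rightarrow> ('x \<Rightarrow> real) \<Rightarrow> real) \<Rightarrow> 'x measure \<Rightarrow> 'x measure \<Rightarrow> real" where
  "mmd S k H ip P Q =
     (let d = (\<lambda>x. mean_embedding S k H ip P x - mean_embedding S k H ip Q x)
      in sqrt (ip d d))"

definition empirical_measure :: "'x measure \<Rightarrow> nat \<Rightarrow> (nat \<Rightarrow> 'x) \<Rightarrow> 'x measure" where
  "empirical_measure M n x =
     measure_of (space M) (sets M)
       (\<lambda>A. ennreal (1 / real n) * (\<Sum>i=1..n. emeasure (return M (x i)) A))"

definition gibbs_measure :: "'t measure \<Rightarrow> real \<Rightarrow> ('t \<Rightarrow> real) \<Rightarrow> 't measure" where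
  "gibbs_measure \<pi> \<beta> L =
     density \<pi> (\<lambda>\<theta>. ennreal (exp (- \<beta> * L \<theta>)) / (\<integral>\<^sup>+ \<tau>. ennreal (exp (- \<beta> * L \<tau>)) \<partial>\<pi>))"

definition mmd_posterior ::
    "'x measure \<Rightarrow> ('x \<Rightarrow> 'x \<Rightarrow> real) \<Rightarrow> ('x \<Rightarrow> real) set \<Rightarrow>
     (('x \<Rightarrow> real) \<Rightarrow> ('x \<Rightarrow> real) \<Rightarrow> real) \<Rightarrow> ('t \<Rightarrow> 'x measure) \<Rightarrow> 't measure \<Rightarrow> real \<Rightarrow>
     nat \<Rightarrow> (nat \<Rightarrow> 'x) \<Rightarrow> 't measure" where
  "mmd_posterior M k H ip P \<pi> \<beta> n x =
     gibbs_measure \<pi> \<beta> (\<lambda>\<theta>. (mmd (space M) k H ip (P \<theta>) (empirical_measure M n x))\<^sup>2)"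

end

theory Submission
  imports Defs
begin

text \<open>
  In the reproducing kernel Hilbert space the maximum mean discrepancy \<open>D\<close> is the norm distance of mean
  embeddings, so its square obeys \<open>D\<^sup>2(P, R) \<le> 2 D\<^sup>2(P, Q) + 2 D\<^sup>2(Q, R)\<close>. Three facts then carry
  the bound.

  First, the pseudo-posterior is a Gibbs measure, hence it nearly minimizes its mean loss
  \<open>D\<^sup>2(P \<theta>, Q)\<close>, with \<open>Q\<close> the empirical measure, penalized by the relative entropy to the prior divided by
  \<open>\<beta>\<close>. The competitor is the prior conditioned on the \<open>n powr (- 1/2)\<close>-ball around \<open>\<theta>s\<close>; the prior
  mass condition says exactly that its penalty is at most \<open>1 / n\<close> (\<open>gibbs_mean_loss_le\<close>).

  Second, three applications of the triangle inequality exchange \<open>Q\<close> with \<open>P0\<close> twice and, on the ball,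
  \<open>P \<theta>\<close> with \<open>P \<theta>s\<close> once. For every sample this gives posterior risk at most
  \<open>8 D\<^sup>2(P \<theta>s, P0) + 10 / n + 6 D\<^sup>2(Q, P0)\<close> (\<open>gibbs_mmd_risk_le\<close>).

  Third, the embedding of \<open>Q\<close> is an average of \<open>n\<close> independent vectors of norm at most 1 with mean the
  embedding of \<open>P0\<close>, so the expectation of \<open>D\<^sup>2(Q, P0)\<close> is at most \<open>1 / n\<close>
  (\<open>expected_mmd_sq_empirical_le\<close>). Taking expectations leaves \<open>8 D\<^sup>2(P \<theta>s, P0) + 16 / n\<close>.

  All of this presupposes that mean embeddings exist and that members of the space are measurable. Both
  follow from one minimization argument, a Riesz theorem relative to a subspace
  (\<open>Riesz_representation_on_subspace\<close>).
\<close>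

section \<open>Hilbert space geometry of a reproducing kernel space\<close>

text \<open>
  The first-order condition at a minimum along a line: near \<open>t = 0\<close> the linear term dominates, so it
  would make the expression negative on one side.
\<close>

lemma nonneg_quadratic_linear_coeff_zero:
  fixes a b :: real
  assumes "\<And>t. 0 \<le> t\<^sup>2 * a + 2 * t * b"
  shows "b = 0"
proof (rule ccontr)
  assume b: "b \<noteq> 0"
  have a: "0 \<le> a"
    using assms[of 1] assms[of "- 1"] by simp
  \<comment> \<open>minimizer of the slightly larger quadratic with leading coefficient \<open>a + 1\<close>, which is positive even if \<open>a = 0\<close>\<close>
  define t where "t = - b / (a + 1)"
  have "t\<^sup>2 * a + 2 * t * b \<le> t\<^sup>2 * (a + 1) + 2 * t * b"
    by (simp add: algebra_simps)
  also have "\<dots> = - (b\<^sup>2 / (a + 1))"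
    using a by (simp add: t_def power2_eq_square divide_simps)
  also have "\<dots> < 0"
    using a b by (simp add: add_nonneg_pos)
  finally show False
    using assms[of t] by simp
qed

context rkhs
begin

abbreviation nrm :: "('x \<Rightarrow> real) \<Rightarrow> real" where
  "nrm f \<equiv> sqrt (ip f f)"

lemma lincomb_mem: "f \<in> H \<Longrightarrow> g \<in> H \<Longrightarrow> (\<lambda>x. a * f x + b * g x) \<in> H"
  by (rule add_mem[OF scale_mem scale_mem])

lemma diff_mem: "f \<in> H \<Longrightarrow> g \<in> H \<Longrightarrow> (\<lambda>x. f x - g x) \<in> H"
  using lincomb_mem[of f g 1 "- 1"] by simp

lemma ip_lincomb_left:
  "f \<in> H \<Longrightarrow> g \<in> H \<Longrightarrow> h \<in> H \<Longrightarrow> ip (\<lambda>x. a * f x + b * g x) h = a * ip f h + b * ip g h"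
  using ip_add_left[OF scale_mem scale_mem, of f g h a b] ip_scale_left[of f h a]
    ip_scale_left[of g h b] by simp

lemma ip_lincomb_right:
  "f \<in> H \<Longrightarrow> g \<in> H \<Longrightarrow> h \<in> H \<Longrightarrow> ip h (\<lambda>x. a * f x + b * g x) = a * ip h f + b * ip h g"
  using ip_lincomb_left[of f g h a b] ip_commute[OF lincomb_mem, of f g h a b]
    ip_commute[of f h] ip_commute[of g h] by simp

lemma ip_diff_left: "f \<in> H \<Longrightarrow> g \<in> H \<Longrightarrow> h \<in> H \<Longrightarrow> ip (\<lambda>x. f x - g x) h = ip f h - ip g h"
  using ip_lincomb_left[of f g h 1 "- 1"] by simp

lemma ip_diff_right: "f \<in> H \<Longrightarrow> g \<in> H \<Longrightarrow> h \<in> H \<Longrightarrow> ip h (\<lambda>x. f x - g x) = ip h f - ip h g"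
  using ip_lincomb_right[of f g h 1 "- 1"] by simp

lemma ip_lincomb_self:
  assumes "f \<in> H" "g \<in> H"
  shows "ip (\<lambda>x. a * f x + b * g x) (\<lambda>x. a * f x + b * g x)
    = a\<^sup>2 * ip f f + 2 * a * b * ip f g + b\<^sup>2 * ip g g"
  using ip_lincomb_left[OF assms lincomb_mem[OF assms], of a b a b]
    ip_lincomb_right[OF assms assms(1), of a b] ip_lincomb_right[OF assms assms(2), of a b]
    ip_commute[OF assms]
  by (simp add: power2_eq_square algebra_simps)

lemma ip_diff_self:
  assumes "f \<in> H" "g \<in> H"
  shows "ip (\<lambda>x. f x - g x) (\<lambda>x. f x - g x) = ip f f - 2 * ip f g + ip g g"
  using ip_lincomb_self[OF assms, of 1 "- 1"] by simp

lemma Cauchy_Schwarz: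
  assumes "f \<in> H" "g \<in> H"
  shows "\<bar>ip f g\<bar> \<le> nrm f * nrm g"
proof -
  have nn: "0 \<le> a\<^sup>2 * ip f f + 2 * a * b * ip f g + b\<^sup>2 * ip g g" for a b
    using ip_nonneg[OF lincomb_mem[OF assms], of a b] unfolding ip_lincomb_self[OF assms] .
  have "(ip f g)\<^sup>2 \<le> ip f f * ip g g"
  proof (cases "ip g g = 0")
    case True
    then show ?thesis
      using ip_definite[OF assms(2)] ip_scale_left[OF assms(2,1), of 0] ip_commute[OF assms] by simp
  next
    case False
    then have pos: "0 < ip g g"
      using ip_nonneg[OF assms(2)] by simp
    have "0 \<le> ip g g * (ip f f * ip g g - (ip f g)\<^sup>2)"
      using nn[of "ip g g" "- ip f g"] by (simp add: power2_eq_square algebra_simps)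
    then show ?thesis
      using pos by (simp add: zero_le_mult_iff)
  qed
  then have "sqrt ((ip f g)\<^sup>2) \<le> sqrt (ip f f * ip g g)"
    by (rule real_sqrt_le_mono)
  then show ?thesis
    by (simp add: real_sqrt_mult)
qed

text \<open>
  The cross term of the expansion is at most the sum of the two squares, whence the factor 2; its
  iteration produces the constants 8 and 16 of the risk bound.
\<close>

lemma sq_norm_diff_triangle:
  assumes "f \<in> H" "g \<in> H" "h \<in> H"
  shows "ip (\<lambda>x. f x - h x) (\<lambda>x. f x - h x)
    \<le> 2 * ip (\<lambda>x. f x - g x) (\<lambda>x. f x - g x) + 2 * ip (\<lambda>x. g x - h x) (\<lambda>x. g x - h x)"
proof -
  have "(\<lambda>x. 1 * (f x - g x) + 1 * (g x - h x)) = (\<lambda>x. f x - h x)"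
    by auto
  then have "ip (\<lambda>x. f x - h x) (\<lambda>x. f x - h x) = ip (\<lambda>x. f x - g x) (\<lambda>x. f x - g x)
      + 2 * ip (\<lambda>x. f x - g x) (\<lambda>x. g x - h x) + ip (\<lambda>x. g x - h x) (\<lambda>x. g x - h x)"
    using ip_lincomb_self[OF diff_mem[OF assms(1,2)] diff_mem[OF assms(2,3)], of 1 1] by simp
  moreover have "0 \<le> ip (\<lambda>x. f x - g x) (\<lambda>x. f x - g x)
      - 2 * ip (\<lambda>x. f x - g x) (\<lambda>x. g x - h x) + ip (\<lambda>x. g x - h x) (\<lambda>x. g x - h x)"
    using ip_lincomb_self[OF diff_mem[OF assms(1,2)] diff_mem[OF assms(2,3)], of 1 "- 1"]
      ip_nonneg[OF lincomb_mem[OF diff_mem[OF assms(1,2)] diff_mem[OF assms(2,3)], of 1 "- 1"]]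
    by simp
  ultimately show ?thesis
    by simp
qed

lemma ip_tendsto:
  assumes "\<And>i. u i \<in> H" "g \<in> H" "h \<in> H"
    and "(\<lambda>i. nrm (\<lambda>x. u i x - g x)) \<longlonglongrightarrow> 0"
  shows "(\<lambda>i. ip (u i) h) \<longlonglongrightarrow> ip g h"
proof -
  have "(\<lambda>i. ip (u i) h - ip g h) \<longlonglongrightarrow> 0"
  proof (rule Lim_null_comparison)
    show "(\<lambda>i. nrm (\<lambda>x. u i x - g x) * nrm h) \<longlonglongrightarrow> 0"
      using tendsto_mult_right[OF assms(4), of "nrm h"] by simp
    show "\<forall>\<^sub>F i in sequentially. norm (ip (u i) h - ip g h) \<le> nrm (\<lambda>x. u i x - g x) * nrm h"
      using Cauchy_Schwarz[OF diff_mem[OF assms(1,2)] assms(3)]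
      by (simp add: ip_diff_left[OF assms(1-3)])
  qed
  then show ?thesis
    by (rule LIM_zero_cancel)
qed

lemma pointwise_tendsto:
  assumes "\<And>i. u i \<in> H" "g \<in> H"
    and "(\<lambda>i. nrm (\<lambda>x. u i x - g x)) \<longlonglongrightarrow> 0"
  shows "(\<lambda>i. u i x) \<longlonglongrightarrow> g x"
proof (cases "x \<in> S")
  case True
  show ?thesis
    using ip_tendsto[OF assms(1,2) section_mem[OF True] assms(3)]
    unfolding reproducing[OF assms(1) True, symmetric] reproducing[OF assms(2) True, symmetric] .
next
  case False
  show ?thesis
    unfolding vanishes_outside[OF assms(1) False] vanishes_outside[OF assms(2) False] by simp
qed

text \<open>
  The limit is taken in \<open>H\<close>, since the subspace \<open>V\<close> may fail to be closed.
\<close>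

lemma minimizing_sequence_converges:
  assumes VH: "V \<subseteq> H"
    and V_lin: "\<And>a b v w. v \<in> V \<Longrightarrow> w \<in> V \<Longrightarrow> (\<lambda>x. a * v x + b * w x) \<in> V"
    and L_lin: "\<And>a b v w. v \<in> V \<Longrightarrow> w \<in> V \<Longrightarrow> L (\<lambda>x. a * v x + b * w x) = a * L v + b * L w"
    and u_mem: "\<And>i. u i \<in> V"
    and u_min: "\<And>i v. v \<in> V \<Longrightarrow> ip (u i) (u i) - 2 * L (u i) < ip v v - 2 * L v + 1 / Suc i"
  obtains g where "g \<in> H" "(\<lambda>i. nrm (\<lambda>x. u i x - g x)) \<longlonglongrightarrow> 0"
proof -
  note VH' = subsetD[OF VH]
  have gap: "ip (\<lambda>x. u i x - u j x) (\<lambda>x. u i x - u j x) < 2 / Suc i + 2 / Suc j" for i j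
  proof -
    \<comment> \<open>comparing both terms with their midpoint turns near-minimality into closeness, by the parallelogram law\<close>
    define m where "m = (\<lambda>x. (1/2) * u i x + (1/2) * u j x)"
    have m: "m \<in> V"
      unfolding m_def by (rule V_lin[OF u_mem u_mem])
    have Lm: "2 * L m = L (u i) + L (u j)"
      using L_lin[OF u_mem[of i] u_mem[of j], of "1/2" "1/2"] by (simp add: m_def)
    have "4 * ip m m = ip (u i) (u i) + 2 * ip (u i) (u j) + ip (u j) (u j)"
      using ip_lincomb_self[OF VH'[OF u_mem[of i]] VH'[OF u_mem[of j]], of "1/2" "1/2"]
      by (simp add: m_def power2_eq_square)
    moreover have "ip (\<lambda>x. u i x - u j x) (\<lambda>x. u i x - u j x)
        = ip (u i) (u i) - 2 * ip (u i) (u j) + ip (u j) (u j)"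
      by (rule ip_diff_self[OF VH'[OF u_mem] VH'[OF u_mem]])
    moreover have "ip (u i) (u i) - 2 * L (u i) < ip m m - 2 * L m + 1 / Suc i"
      "ip (u j) (u j) - 2 * L (u j) < ip m m - 2 * L m + 1 / Suc j"
      using u_min[OF m] by auto
    ultimately show ?thesis
      using Lm by simp
  qed
  have "\<exists>N. \<forall>i\<ge>N. \<forall>j\<ge>N. nrm (\<lambda>x. u i x - u j x) < e" if e: "0 < e" for e
  proof -
    obtain N where N: "inverse (real (Suc N)) < e\<^sup>2 / 4"
      using reals_Archimedean[of "e\<^sup>2 / 4"] e by auto
    have "nrm (\<lambda>x. u i x - u j x) < e" if "N \<le> i" "N \<le> j" for i j
    proof -
      have "1 / real (Suc i) \<le> 1 / real (Suc N)" "1 / real (Suc j) \<le> 1 / real (Suc N)"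
        using that by (auto intro!: divide_left_mono)
      then have "2 / real (Suc i) + 2 / real (Suc j) < e\<^sup>2"
        using N by (simp add: inverse_eq_divide)
      then have "ip (\<lambda>x. u i x - u j x) (\<lambda>x. u i x - u j x) < e\<^sup>2"
        using gap[of i j] by linarith
      then show ?thesis
        using e by (simp add: real_less_lsqrt)
    qed
    then show ?thesis
      by blast
  qed
  then have "\<exists>g\<in>H. (\<lambda>i. nrm (\<lambda>x. u i x - g x)) \<longlonglongrightarrow> 0"
    by (rule complete[OF VH'[OF u_mem]])
  then show ?thesis
    using that by blast
qed

text \<open>
  The representer minimizes \<open>\<langle>v, v\<rangle> - 2 L v\<close>. A minimizing sequence converges, and the first-order
  condition along the direction \<open>v\<close>, passed to the limit, reads \<open>\<langle>g, v\<rangle> = L v\<close>. For \<open>V = H\<close> this is the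
  Riesz theorem, which yields mean embeddings. For a proper subspace and \<open>L v = \<langle>v, f\<rangle>\<close> it yields
  the projection of \<open>f\<close> onto the closure of \<open>V\<close>, and the sequence \<open>u\<close> exhibits that membership.
\<close>

lemma Riesz_representation_on_subspace:
  assumes VH: "V \<subseteq> H" and V_nonempty: "V \<noteq> {}"
    and V_lin: "\<And>a b v w. v \<in> V \<Longrightarrow> w \<in> V \<Longrightarrow> (\<lambda>x. a * v x + b * w x) \<in> V"
    and L_lin: "\<And>a b v w. v \<in> V \<Longrightarrow> w \<in> V \<Longrightarrow> L (\<lambda>x. a * v x + b * w x) = a * L v + b * L w"
    and L_bdd: "\<And>v. v \<in> V \<Longrightarrow> \<bar>L v\<bar> \<le> C * nrm v"
  shows "\<exists>u g. (\<forall>i :: nat. u i \<in> V) \<and> g \<in> H \<and> (\<lambda>i. nrm (\<lambda>x. u i x - g x)) \<longlonglongrightarrow> 0 \<and>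
    (\<forall>v\<in>V. ip v g = L v)"
proof -
  note VH' = subsetD[OF VH]
  define J where "J v = ip v v - 2 * L v" for v
  have J_lower: "- (C\<^sup>2) \<le> J v" if "v \<in> V" for v
  proof -
    have "ip v v = (nrm v)\<^sup>2"
      using ip_nonneg VH' that by simp
    moreover have "0 \<le> (nrm v - C)\<^sup>2"
      by simp
    ultimately show ?thesis
      using L_bdd[OF that] unfolding J_def by (simp only: power2_diff) (simp add: algebra_simps)
  qed
  then have bdd: "bdd_below (J ` V)"
    by (intro bdd_belowI2)
  define m where "m = Inf (J ` V)"
  have m_le: "m \<le> J v" if "v \<in> V" for v
    unfolding m_def using bdd that by (simp add: cINF_lower)
  have "\<exists>v\<in>V. J v < m + 1 / Suc i" for i
  proof -
    have "Inf (J ` V) < m + 1 / Suc i"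
      by (simp add: m_def)
    from cInf_lessD[OF _ this] show ?thesis
      using V_nonempty by auto
  qed
  then obtain u where u: "\<And>i. u i \<in> V" and Ju: "\<And>i. J (u i) < m + 1 / Suc i"
    by metis
  have u_min: "ip (u i) (u i) - 2 * L (u i) < ip v v - 2 * L v + 1 / Suc i" if "v \<in> V" for i v
    using Ju[of i] m_le[OF that] by (simp add: J_def)
  obtain g where g: "g \<in> H" and lim: "(\<lambda>i. nrm (\<lambda>x. u i x - g x)) \<longlonglongrightarrow> 0"
    by (rule minimizing_sequence_converges[OF VH V_lin L_lin u u_min])
  have "ip v g = L v" if v: "v \<in> V" for v
  proof -
    have "0 \<le> t\<^sup>2 * ip v v + 2 * t * (ip g v - L v)" for t
    proof (rule LIMSEQ_le_const)
      show "(\<lambda>i. t\<^sup>2 * ip v v + 2 * t * (ip (u i) v - L v) + inverse (Suc i))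
          \<longlonglongrightarrow> t\<^sup>2 * ip v v + 2 * t * (ip g v - L v)"
        by (rule tendsto_eq_rhs[where x = "t\<^sup>2 * ip v v + 2 * t * (ip g v - L v) + 0"])
          (intro tendsto_add tendsto_mult tendsto_diff tendsto_const LIMSEQ_inverse_real_of_nat
            ip_tendsto[OF VH'[OF u] g VH'[OF v] lim], simp)
      have "0 \<le> t\<^sup>2 * ip v v + 2 * t * (ip (u i) v - L v) + inverse (Suc i)" for i
        using u_min[OF V_lin[OF u v, of 1 i t], of i] ip_lincomb_self[OF VH'[OF u] VH'[OF v], of 1 i t]
          L_lin[OF u v, of 1 i t]
        by (simp add: algebra_simps inverse_eq_divide)
      then show "\<exists>N. \<forall>i\<ge>N. 0 \<le> t\<^sup>2 * ip v v + 2 * t * (ip (u i) v - L v) + inverse (Suc i)"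
        by blast
    qed
    then have "ip g v - L v = 0"
      by (rule nonneg_quadratic_linear_coeff_zero)
    then show ?thesis
      using ip_commute[OF g VH'[OF v]] by simp
  qed
  with u g lim show ?thesis
    by (intro exI[of _ u] exI[of _ g]) simp
qed

text \<open>
  The projection \<open>g\<close> of \<open>f\<close> onto the closure of \<open>V\<close> has the same inner product with every kernel section as
  \<open>f\<close>. By the reproducing property \<open>g\<close> and \<open>f\<close> have the same values, so \<open>f\<close> lies in the closure, and
  norm convergence implies pointwise convergence.
\<close>

lemma subspace_with_sections_dense:
  assumes VH: "V \<subseteq> H"
    and V_lin: "\<And>a b v w. v \<in> V \<Longrightarrow> w \<in> V \<Longrightarrow> (\<lambda>x. a * v x + b * w x) \<in> V"
    and V_zero: "(\<lambda>_. 0) \<in> V"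
    and V_section: "\<And>x. x \<in> S \<Longrightarrow> kernel_section S k x \<in> V"
    and f: "f \<in> H"
  shows "\<exists>u. (\<forall>i :: nat. u i \<in> V) \<and> (\<forall>x. (\<lambda>i. u i x) \<longlonglongrightarrow> f x)"
proof -
  note VH' = subsetD[OF VH]
  have "V \<noteq> {}"
    using V_zero by blast
  have bdd: "\<bar>ip v f\<bar> \<le> nrm f * nrm v" if "v \<in> V" for v
    using Cauchy_Schwarz[OF VH'[OF that] f] by (simp add: mult.commute)
  have "\<exists>u g. (\<forall>i :: nat. u i \<in> V) \<and> g \<in> H \<and> (\<lambda>i. nrm (\<lambda>x. u i x - g x)) \<longlonglongrightarrow> 0 \<and>
      (\<forall>v\<in>V. ip v g = ip v f)"
    by (rule Riesz_representation_on_subspace[OF VH \<open>V \<noteq> {}\<close> V_lin ip_lincomb_left[OF VH' VH' f] bdd])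
  then obtain u g where u: "\<And>i :: nat. u i \<in> V" and g: "g \<in> H"
    and lim: "(\<lambda>i. nrm (\<lambda>x. u i x - g x)) \<longlonglongrightarrow> 0" and rep: "\<And>v. v \<in> V \<Longrightarrow> ip v g = ip v f"
    by blast
  have "g = f"
  proof
    fix x
    show "g x = f x"
    proof (cases "x \<in> S")
      case True
      have "g x = ip (kernel_section S k x) g"
        using reproducing[OF g True] ip_commute[OF g section_mem[OF True]] by simp
      also have "\<dots> = ip f (kernel_section S k x)"
        using rep[OF V_section[OF True]] ip_commute[OF f section_mem[OF True]] by simp
      also have "\<dots> = f x"
        by (rule reproducing[OF f True, symmetric])
      finally show ?thesis .
    next
      case False
      show ?thesis
        using vanishes_outside[OF f False] vanishes_outside[OF g False] by simp
    qed
  qed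
  show ?thesis
    using u pointwise_tendsto[OF VH'[OF u] g lim] unfolding \<open>g = f\<close>
    by (intro exI[of _ u]) simp
qed

end

section \<open>Mean embeddings and the maximum mean discrepancy\<close>

locale bounded_measurable_rkhs = rkhs "space M" k H ip
  for M :: "'x measure" and k H ip +
  assumes kernel_measurable: "(\<lambda>(x, y). k x y) \<in> borel_measurable (M \<Otimes>\<^sub>M M)"
    and kernel_bounded: "\<And>x y. x \<in> space M \<Longrightarrow> y \<in> space M \<Longrightarrow> \<bar>k x y\<bar> \<le> 1"
begin

abbreviation ksec :: "'x \<Rightarrow> 'x \<Rightarrow> real" where
  "ksec \<equiv> kernel_section (space M) k"

abbreviation emb :: "'x measure \<Rightarrow> 'x \<Rightarrow> real" where
  "emb \<equiv> mean_embedding (space M) k H ip"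

abbreviation mmd_dist :: "'x measure \<Rightarrow> 'x measure \<Rightarrow> real" where
  "mmd_dist \<equiv> mmd (space M) k H ip"

lemma prob_algebraD:
  assumes "P \<in> space (prob_algebra M)"
  shows "prob_space P" "sets P = sets M" "space P = space M"
  using assms by (auto simp: space_prob_algebra dest: sets_eq_imp_space_eq)

text \<open>
  The measurable members of \<open>H\<close> form a subspace that contains the kernel sections. Every member is
  therefore a pointwise limit of measurable ones.
\<close>

lemma member_measurable:
  assumes f: "f \<in> H"
  shows "f \<in> borel_measurable M"
proof -
  define V where "V = {v \<in> H. v \<in> borel_measurable M}"
  have VH: "V \<subseteq> H"
    by (auto simp: V_def)
  have V_lin: "(\<lambda>x. a * v x + b * w x) \<in> V" if "v \<in> V" "w \<in> V" for a b v w
    using that lincomb_mem[of v w a b] unfolding V_def by auto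
  have V_zero: "(\<lambda>_. 0) \<in> V"
    using zero_mem by (simp add: V_def)
  have V_section: "ksec x \<in> V" if x: "x \<in> space M" for x
  proof -
    have "(\<lambda>y. k x y) \<in> borel_measurable M"
      using measurable_Pair2[OF kernel_measurable x] by simp
    then have "ksec x \<in> borel_measurable M"
      by (subst measurable_cong[where g = "k x"]) (auto simp: kernel_section_def)
    then show ?thesis
      using section_mem[OF x] by (simp add: V_def)
  qed
  have "\<exists>u. (\<forall>i :: nat. u i \<in> V) \<and> (\<forall>x. (\<lambda>i. u i x) \<longlonglongrightarrow> f x)"
    by (rule subspace_with_sections_dense[OF VH V_lin V_zero V_section f])
  then obtain u where u: "\<And>i :: nat. u i \<in> V" and lim: "\<And>x. (\<lambda>i. u i x) \<longlonglongrightarrow> f x"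
    by blast
  have "u i \<in> borel_measurable M" for i
    using u[of i] by (simp add: V_def)
  then show ?thesis
    using lim by (rule borel_measurable_LIMSEQ_real[rotated])
qed

lemma ip_section_section:
  assumes "x \<in> space M" "y \<in> space M"
  shows "ip (ksec x) (ksec y) = k x y"
  using reproducing[OF section_mem[OF assms(1)] assms(2)] assms by (simp add: kernel_section_def)

lemma abs_le_nrm:
  assumes f: "f \<in> H" and x: "x \<in> space M"
  shows "\<bar>f x\<bar> \<le> nrm f"
proof -
  have "\<bar>f x\<bar> \<le> nrm f * nrm (ksec x)"
    using Cauchy_Schwarz[OF f section_mem[OF x]] reproducing[OF f x] by simp
  also have "nrm (ksec x) \<le> 1"
    using kernel_bounded[OF x x] ip_section_section[OF x x] by simp
  then have "nrm f * nrm (ksec x) \<le> nrm f"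
    using ip_nonneg[OF f] by (simp add: mult_left_le)
  finally show ?thesis .
qed

lemma member_integrable:
  assumes f: "f \<in> H" and P: "P \<in> space (prob_algebra M)"
  shows "integrable P f"
proof -
  interpret P: prob_space P
    by (rule prob_algebraD[OF P])
  show ?thesis
  proof (rule P.integrable_const_bound)
    show "AE x in P. norm (f x) \<le> nrm f"
      using abs_le_nrm[OF f] by (intro AE_I2) (simp add: prob_algebraD[OF P])
    show "f \<in> borel_measurable P"
      using member_measurable[OF f] measurable_cong_sets[OF prob_algebraD(2)[OF P] refl] by blast
  qed
qed

text \<open>
  Integration against \<open>P\<close> is a linear functional of norm at most 1 because \<open>k(x, x) \<le> 1\<close>; the mean
  embedding is its representer.
\<close>

lemma ex_mean_embedding:
  assumes P: "P \<in> space (prob_algebra M)"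
  obtains g where "g \<in> H" "\<And>f. f \<in> H \<Longrightarrow> ip f g = (\<integral>x. f x \<partial>P)"
proof -
  interpret P: prob_space P
    by (rule prob_algebraD[OF P])
  have lin: "(\<integral>x. a * f x + b * g x \<partial>P) = a * (\<integral>x. f x \<partial>P) + b * (\<integral>x. g x \<partial>P)"
    if "f \<in> H" "g \<in> H" for a b f g
    using member_integrable[OF that(1) P] member_integrable[OF that(2) P] by simp
  have bdd: "\<bar>\<integral>x. f x \<partial>P\<bar> \<le> 1 * nrm f" if f: "f \<in> H" for f
  proof -
    have bound: "\<bar>f x\<bar> \<le> nrm f" if "x \<in> space P" for x
      using abs_le_nrm[OF f] that by (simp add: prob_algebraD[OF P])
    have "(\<integral>x. f x \<partial>P) \<le> nrm f"
      using bound by (intro P.integral_le_const member_integrable[OF f P] AE_I2) (simp add: abs_le_iff)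
    moreover have "- nrm f \<le> (\<integral>x. f x \<partial>P)"
      using bound by (intro P.integral_ge_const member_integrable[OF f P] AE_I2) (force simp: abs_le_iff)
    ultimately show ?thesis
      by simp
  qed
  have "H \<noteq> {}"
    using zero_mem by blast
  have "\<exists>u g. (\<forall>i :: nat. u i \<in> H) \<and> g \<in> H \<and> (\<lambda>i. nrm (\<lambda>x. u i x - g x)) \<longlonglongrightarrow> 0 \<and>
      (\<forall>f\<in>H. ip f g = (\<integral>x. f x \<partial>P))"
    by (rule Riesz_representation_on_subspace[OF subset_refl \<open>H \<noteq> {}\<close> lincomb_mem lin bdd])
  then show ?thesis
    using that by blast
qed

lemma mean_embedding:
  assumes P: "P \<in> space (prob_algebra M)"
  shows mean_embedding_mem: "emb P \<in> H"
    and ip_mean_embedding: "\<And>f. f \<in> H \<Longrightarrow> ip f (emb P) = (\<integral>x. f x \<partial>P)"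
proof -
  define is_emb where "is_emb g \<longleftrightarrow> g \<in> H \<and>
        (\<forall>f\<in>H. integrable P (\<lambda>x. ip f (ksec x)) \<and> ip f g = (\<integral>x. ip f (ksec x) \<partial>P))" for g
  have int_cong: "(\<integral>x. ip f (ksec x) \<partial>P) = (\<integral>x. f x \<partial>P)" if "f \<in> H" for f
    using reproducing[OF that, symmetric]
    by (intro Bochner_Integration.integral_cong) (simp_all add: prob_algebraD[OF P])
  have int: "integrable P (\<lambda>x. ip f (ksec x))" if "f \<in> H" for f
    using member_integrable[OF that P] reproducing[OF that, symmetric]
    by (subst Bochner_Integration.integrable_cong[where g = f]) (simp_all add: prob_algebraD[OF P])
  obtain g where g: "g \<in> H" "\<And>f. f \<in> H \<Longrightarrow> ip f g = (\<integral>x. f x \<partial>P)"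
    by (rule ex_mean_embedding[OF P]) blast
  have "is_emb g"
    using g int int_cong unfolding is_emb_def by simp
  moreover have "g' = g" if "is_emb g'" for g'
  proof -
    have g': "g' \<in> H" and "\<And>f. f \<in> H \<Longrightarrow> ip f g' = ip f g"
      using that int_cong g unfolding is_emb_def by auto
    then have "ip (\<lambda>x. g' x - g x) (\<lambda>x. g' x - g x) = 0"
      using diff_mem[OF g' g(1)] by (simp add: ip_diff_right[OF g' g(1)])
    then have "(\<lambda>x. g' x - g x) = (\<lambda>_. 0)"
      by (rule ip_definite[OF diff_mem[OF g' g(1)]])
    then show ?thesis
      by (simp add: fun_eq_iff)
  qed
  ultimately have "is_emb (THE g. is_emb g)"
    by (rule theI)
  then have "is_emb (emb P)"
    unfolding mean_embedding_def is_emb_def .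
  then show "emb P \<in> H" "\<And>f. f \<in> H \<Longrightarrow> ip f (emb P) = (\<integral>x. f x \<partial>P)"
    using int_cong unfolding is_emb_def by auto
qed

lemma mean_embedding_apply:
  assumes P: "P \<in> space (prob_algebra M)" and x: "x \<in> space M"
  shows "emb P x = (\<integral>y. k x y \<partial>P)"
proof -
  have "emb P x = ip (ksec x) (emb P)"
    using reproducing[OF mean_embedding_mem[OF P] x]
      ip_commute[OF mean_embedding_mem[OF P] section_mem[OF x]] by simp
  also have "\<dots> = (\<integral>y. ksec x y \<partial>P)"
    by (rule ip_mean_embedding[OF P section_mem[OF x]])
  also have "\<dots> = (\<integral>y. k x y \<partial>P)"
    by (intro Bochner_Integration.integral_cong) (auto simp: kernel_section_def prob_algebraD[OF P])
  finally show ?thesis .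
qed

lemma kernel_integrable_pair:
  assumes P: "P \<in> space (prob_algebra M)" and Q: "Q \<in> space (prob_algebra M)"
  shows "integrable (P \<Otimes>\<^sub>M Q) (\<lambda>(x, y). k x y)"
proof -
  interpret P: prob_space P by (rule prob_algebraD[OF P])
  interpret Q: prob_space Q by (rule prob_algebraD[OF Q])
  interpret PQ: pair_prob_space P Q ..
  show ?thesis
  proof (rule PQ.integrable_const_bound)
    show "AE z in P \<Otimes>\<^sub>M Q. norm (case z of (x, y) \<Rightarrow> k x y) \<le> 1"
      using kernel_bounded
      by (intro AE_I2) (auto simp: space_pair_measure prob_algebraD[OF P] prob_algebraD[OF Q])
    show "(\<lambda>(x, y). k x y) \<in> borel_measurable (P \<Otimes>\<^sub>M Q)"
      using kernel_measurable
        measurable_cong_sets[OF sets_pair_measure_cong[OF prob_algebraD(2)[OF P] prob_algebraD(2)[OF Q]] refl]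
      by blast
  qed
qed

text \<open>
  This is \<open>\<langle>\<mu>(P), \<mu>(Q)\<rangle>\<close>, written over the product measure: in this form it depends
  measurably on \<open>P\<close> and \<open>Q\<close>, and it matches the expectation of \<open>k\<close> at two independent points.
\<close>

lemma integral_mean_embedding:
  assumes P: "P \<in> space (prob_algebra M)" and Q: "Q \<in> space (prob_algebra M)"
  shows "(\<integral>x. emb Q x \<partial>P) = (\<integral>z. (case z of (x, y) \<Rightarrow> k x y) \<partial>(P \<Otimes>\<^sub>M Q))"
proof -
  interpret P: prob_space P by (rule prob_algebraD[OF P])
  interpret Q: prob_space Q by (rule prob_algebraD[OF Q])
  interpret PQ: pair_prob_space P Q ..
  have "(\<integral>x. emb Q x \<partial>P) = (\<integral>x. (\<integral>y. k x y \<partial>Q) \<partial>P)"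
    by (intro Bochner_Integration.integral_cong refl mean_embedding_apply[OF Q])
      (simp add: prob_algebraD[OF P])
  also have "\<dots> = (\<integral>z. (case z of (x, y) \<Rightarrow> k x y) \<partial>(P \<Otimes>\<^sub>M Q))"
    by (rule PQ.integral_fst[OF kernel_integrable_pair[OF P Q]])
  finally show ?thesis .
qed

lemma mmd_nonneg:
  assumes P: "P \<in> space (prob_algebra M)" and Q: "Q \<in> space (prob_algebra M)"
  shows "0 \<le> mmd_dist P Q"
  using ip_nonneg[OF diff_mem[OF mean_embedding_mem[OF P] mean_embedding_mem[OF Q]]]
  by (simp add: mmd_def Let_def)

lemma mmd_sq:
  assumes P: "P \<in> space (prob_algebra M)" and Q: "Q \<in> space (prob_algebra M)"
  shows "(mmd_dist P Q)\<^sup>2 = ip (\<lambda>x. emb P x - emb Q x) (\<lambda>x. emb P x - emb Q x)"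
  using ip_nonneg[OF diff_mem[OF mean_embedding_mem[OF P] mean_embedding_mem[OF Q]]]
  by (simp add: mmd_def Let_def)

lemma mmd_sq_eq_integrals:
  assumes P: "P \<in> space (prob_algebra M)" and Q: "Q \<in> space (prob_algebra M)"
  shows "(mmd_dist P Q)\<^sup>2 = (\<integral>x. emb P x \<partial>P) - 2 * (\<integral>x. emb Q x \<partial>P) + (\<integral>x. emb Q x \<partial>Q)"
  unfolding mmd_sq[OF P Q] ip_diff_self[OF mean_embedding_mem[OF P] mean_embedding_mem[OF Q]]
  using ip_mean_embedding[OF P mean_embedding_mem[OF P]] ip_mean_embedding[OF P mean_embedding_mem[OF Q]]
    ip_mean_embedding[OF Q mean_embedding_mem[OF Q]]
    ip_commute[OF mean_embedding_mem[OF P] mean_embedding_mem[OF Q]]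
  by simp

lemma mmd_sq_triangle:
  assumes "P \<in> space (prob_algebra M)" "Q \<in> space (prob_algebra M)" "R \<in> space (prob_algebra M)"
  shows "(mmd_dist P R)\<^sup>2 \<le> 2 * (mmd_dist P Q)\<^sup>2 + 2 * (mmd_dist Q R)\<^sup>2"
  using sq_norm_diff_triangle[OF assms[THEN mean_embedding_mem]] by (simp add: mmd_sq assms)

lemma mmd_sq_commute:
  assumes P: "P \<in> space (prob_algebra M)" and Q: "Q \<in> space (prob_algebra M)"
  shows "(mmd_dist P Q)\<^sup>2 = (mmd_dist Q P)\<^sup>2"
  unfolding mmd_sq[OF P Q] mmd_sq[OF Q P]
    ip_diff_self[OF mean_embedding_mem[OF P] mean_embedding_mem[OF Q]]
    ip_diff_self[OF mean_embedding_mem[OF Q] mean_embedding_mem[OF P]]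
    ip_commute[OF mean_embedding_mem[OF Q] mean_embedding_mem[OF P]]
  by simp

lemma mmd_sq_measurable:
  assumes P[measurable]: "P \<in> T \<rightarrow>\<^sub>M prob_algebra M" and Q: "Q \<in> space (prob_algebra M)"
  shows "(\<lambda>\<theta>. (mmd_dist (P \<theta>) Q)\<^sup>2) \<in> borel_measurable T"
proof -
  have P_sub[measurable]: "P \<in> T \<rightarrow>\<^sub>M subprob_algebra M"
    by (rule measurable_prob_algebraD[OF P])
  have [measurable]: "emb Q \<in> borel_measurable M"
    by (rule member_measurable[OF mean_embedding_mem[OF Q]])
  have pair: "(\<lambda>\<theta>. P \<theta> \<Otimes>\<^sub>M P \<theta>) \<in> T \<rightarrow>\<^sub>M subprob_algebra (M \<Otimes>\<^sub>M M)"
    by (rule measurable_pair_measure[OF P_sub P_sub])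
  have m1: "(\<lambda>\<theta>. \<integral>z. (case z of (x, y) \<Rightarrow> k x y) \<partial>(P \<theta> \<Otimes>\<^sub>M P \<theta>)) \<in> borel_measurable T"
    by (rule measurable_compose[OF pair integral_measurable_subprob_algebra[OF kernel_measurable]])
  have m2: "(\<lambda>\<theta>. \<integral>x. emb Q x \<partial>P \<theta>) \<in> borel_measurable T"
    by (rule measurable_compose[OF P_sub integral_measurable_subprob_algebra]) simp
  have "(\<lambda>\<theta>. (\<integral>z. (case z of (x, y) \<Rightarrow> k x y) \<partial>(P \<theta> \<Otimes>\<^sub>M P \<theta>)) - 2 * (\<integral>x. emb Q x \<partial>P \<theta>)
      + (\<integral>x. emb Q x \<partial>Q)) \<in> borel_measurable T"
    using m1 m2 by simp
  also have "?this \<longleftrightarrow> (\<lambda>\<theta>. (mmd_dist (P \<theta>) Q)\<^sup>2) \<in> borel_measurable T"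
  proof (rule measurable_cong)
    fix \<theta> assume "\<theta> \<in> space T"
    then have "P \<theta> \<in> space (prob_algebra M)"
      by (rule measurable_space[OF P])
    then show "(\<integral>z. (case z of (x, y) \<Rightarrow> k x y) \<partial>(P \<theta> \<Otimes>\<^sub>M P \<theta>)) - 2 * (\<integral>x. emb Q x \<partial>P \<theta>)
        + (\<integral>x. emb Q x \<partial>Q) = (mmd_dist (P \<theta>) Q)\<^sup>2"
      by (simp add: mmd_sq_eq_integrals integral_mean_embedding Q)
  qed
  finally show ?thesis .
qed

end

section \<open>Gibbs measures\<close>

text \<open>
  The Donsker--Varadhan inequality in the form needed here: comparing the Gibbs measure with the prior
  conditioned on \<open>B\<close>, its mean loss is at most the loss on \<open>B\<close> plus \<open>1 / \<beta>\<close> times the relative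
  entropy \<open>- ln (\<pi> B)\<close>. The proof combines two facts: the normalizing constant is at least
  \<open>exp (- \<beta> a) \<pi> B\<close>, and the relative entropy of the Gibbs measure with respect to \<open>\<pi>\<close> is nonnegative.
\<close>

lemma gibbs_mean_loss_le:
  fixes L :: "'t \<Rightarrow> real"
  assumes "prob_space \<pi>" and L[measurable]: "L \<in> borel_measurable \<pi>"
    and L_nonneg: "\<And>\<theta>. 0 \<le> L \<theta>" and \<beta>: "0 < \<beta>"
    and B: "B \<in> sets \<pi>" and L_le: "\<And>\<theta>. \<theta> \<in> B \<Longrightarrow> L \<theta> \<le> a"
    and mass: "exp (- \<beta> * r) \<le> measure \<pi> B" and ar: "0 \<le> a" "0 \<le> r"
  shows prob_space_gibbs_measure: "prob_space (gibbs_measure \<pi> \<beta> L)"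
    and "(\<integral>\<^sup>+ \<theta>. ennreal (L \<theta>) \<partial>gibbs_measure \<pi> \<beta> L) \<le> ennreal (a + r)"
proof -
  interpret prob_space \<pi> by fact
  define Z where "Z = (\<integral>\<^sup>+ \<tau>. ennreal (exp (- \<beta> * L \<tau>)) \<partial>\<pi>)"
  have "Z \<le> (\<integral>\<^sup>+ \<tau>. 1 \<partial>\<pi>)"
    unfolding Z_def using \<beta> L_nonneg by (intro nn_integral_mono) (simp add: ennreal_le_1)
  then have Z_le: "Z \<le> 1"
    by (simp add: emeasure_space_1)
  have "ennreal (exp (- \<beta> * (a + r))) = ennreal (exp (- \<beta> * a)) * ennreal (exp (- \<beta> * r))"
    by (simp add: ennreal_mult[symmetric] exp_add[symmetric] algebra_simps)
  also have "\<dots> \<le> ennreal (exp (- \<beta> * a)) * emeasure \<pi> B"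
    using mass by (intro mult_left_mono) (simp_all add: emeasure_eq_measure)
  also have "\<dots> = (\<integral>\<^sup>+ \<tau>. ennreal (exp (- \<beta> * a)) * indicator B \<tau> \<partial>\<pi>)"
    using B by (simp add: nn_integral_cmult_indicator)
  also have "\<dots> \<le> Z"
    unfolding Z_def using \<beta> L_le by (intro nn_integral_mono) (auto split: split_indicator)
  finally have Z_ge: "ennreal (exp (- \<beta> * (a + r))) \<le> Z" .
  define z where "z = enn2real Z"
  have Zz: "Z = ennreal z"
    using Z_le unfolding z_def by (metis ennreal_enn2real ennreal_one_less_top order_le_less_trans)
  have z_ge: "exp (- \<beta> * (a + r)) \<le> z"
    using Z_ge unfolding Zz by (subst (asm) ennreal_le_iff) (auto simp: z_def)
  then have z_pos: "0 < z"
    by (meson exp_gt_zero less_le_trans)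
  define u where "u \<theta> = exp (- \<beta> * L \<theta>) / z" for \<theta>
  have u_nonneg: "0 \<le> u \<theta>" for \<theta>
    using z_pos by (simp add: u_def)
  have [measurable]: "u \<in> borel_measurable \<pi>"
    unfolding u_def by measurable
  have gibbs: "gibbs_measure \<pi> \<beta> L = density \<pi> (\<lambda>\<theta>. ennreal (u \<theta>))"
    unfolding gibbs_measure_def Z_def[symmetric] Zz u_def using z_pos by (simp add: divide_ennreal)
  have "(\<integral>\<^sup>+ \<theta>. ennreal (u \<theta>) \<partial>\<pi>) = (\<integral>\<^sup>+ \<theta>. ennreal (exp (- \<beta> * L \<theta>)) / ennreal z \<partial>\<pi>)"
    using z_pos by (simp add: u_def divide_ennreal)
  also have "\<dots> = Z / ennreal z"
    unfolding Z_def by (rule nn_integral_divide) simp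
  finally have int_u: "(\<integral>\<^sup>+ \<theta>. ennreal (u \<theta>) \<partial>\<pi>) = 1"
    using z_pos unfolding Zz by (simp add: divide_ennreal)
  show "prob_space (gibbs_measure \<pi> \<beta> L)"
    unfolding gibbs by (rule prob_spaceI) (simp add: emeasure_density cong: nn_integral_cong, simp add: int_u)
  \<comment> \<open>the pointwise form \<open>u - 1 \<le> u * ln u\<close> of nonnegative entropy, rearranged so that both sides are nonnegative and the extended integral is additive\<close>
  have entropy: "\<beta> * L \<theta> * u \<theta> + u \<theta> \<le> \<beta> * (a + r) * u \<theta> + 1" for \<theta>
  proof -
    have u_pos: "0 < u \<theta>"
      using z_pos by (simp add: u_def)
    have "ln (1 / u \<theta>) \<le> 1 / u \<theta> - 1"
      using u_pos by (intro ln_le_minus_one) simp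
    then have "u \<theta> * (1 - 1 / u \<theta>) \<le> u \<theta> * ln (u \<theta>)"
      using u_pos by (intro mult_left_mono) (simp_all add: ln_div)
    then have "u \<theta> - 1 \<le> u \<theta> * ln (u \<theta>)"
      using u_pos by (simp add: right_diff_distrib)
    also have "ln (u \<theta>) = - \<beta> * L \<theta> - ln z"
      using z_pos by (simp add: u_def ln_div)
    also have "- ln z \<le> \<beta> * (a + r)"
      using ln_mono[OF z_ge exp_gt_zero] by simp
    then have "u \<theta> * (- \<beta> * L \<theta> - ln z) \<le> u \<theta> * (- \<beta> * L \<theta> + \<beta> * (a + r))"
      using u_pos by (intro mult_left_mono) simp_all
    finally show ?thesis
      by (simp add: algebra_simps)
  qed
  define I where "I = (\<integral>\<^sup>+ \<theta>. ennreal (L \<theta>) \<partial>gibbs_measure \<pi> \<beta> L)"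
  have I: "I = (\<integral>\<^sup>+ \<theta>. ennreal (u \<theta>) * ennreal (L \<theta>) \<partial>\<pi>)"
    unfolding I_def gibbs by (rule nn_integral_density) measurable
  have "ennreal \<beta> * I + 1 = (\<integral>\<^sup>+ \<theta>. ennreal \<beta> * (ennreal (u \<theta>) * ennreal (L \<theta>)) + ennreal (u \<theta>) \<partial>\<pi>)"
    unfolding I by (subst nn_integral_add) (simp_all add: nn_integral_cmult int_u)
  also have "\<dots> = (\<integral>\<^sup>+ \<theta>. ennreal (\<beta> * L \<theta> * u \<theta> + u \<theta>) \<partial>\<pi>)"
    using \<beta> L_nonneg u_nonneg by (simp add: ennreal_mult ennreal_plus mult_ac)
  also have "\<dots> \<le> (\<integral>\<^sup>+ \<theta>. ennreal (\<beta> * (a + r) * u \<theta> + 1) \<partial>\<pi>)"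
    using entropy by (intro nn_integral_mono ennreal_leI)
  also have "\<dots> = (\<integral>\<^sup>+ \<theta>. ennreal (\<beta> * (a + r)) * ennreal (u \<theta>) + 1 \<partial>\<pi>)"
    using \<beta> ar u_nonneg by (simp add: ennreal_mult ennreal_plus)
  also have "\<dots> = ennreal (\<beta> * (a + r)) + 1"
    by (subst nn_integral_add) (simp_all add: nn_integral_cmult int_u emeasure_space_1)
  finally have "ennreal \<beta> * I \<le> ennreal \<beta> * ennreal (a + r)"
    using \<beta> ar by (simp add: ennreal_mult ennreal_add_left_cancel_le add.commute)
  then show "I \<le> ennreal (a + r)"
    using \<beta> by (subst (asm) ennreal_mult_le_mult_iff) simp_all
qed

section \<open>Empirical measures and independence\<close>

text \<open>
  Writing the empirical measure as an image measure makes its countable additivity and its integrals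
  consequences of general facts.
\<close>

lemma empirical_measure_eq_distr:
  assumes x: "\<And>i. i \<in> {1..n} \<Longrightarrow> x i \<in> space M"
  shows "empirical_measure M n x = distr (uniform_count_measure {1..n}) M x"
proof -
  have x_meas: "x \<in> uniform_count_measure {1..n} \<rightarrow>\<^sub>M M"
    using x by (simp add: measurable_def sets_uniform_count_measure space_uniform_count_measure)
  have "emeasure (distr (uniform_count_measure {1..n}) M x) A
      = ennreal (1 / real n) * (\<Sum>i=1..n. emeasure (return M (x i)) A)" if A: "A \<in> sets M" for A
  proof -
    have "(\<Sum>i=1..n. emeasure (return M (x i)) A) = (\<Sum>i=1..n. ennreal (indicator A (x i)))"
      using A by (intro sum.cong) (simp_all split: split_indicator)
    also have "\<dots> = ennreal (\<Sum>i=1..n. indicator A (x i))"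
      by (rule sum_ennreal) simp
    also have "(\<Sum>i=1..n. indicator A (x i)) = real (card (x -` A \<inter> {1..n}))"
      by (simp add: indicator_def sum.If_cases vimage_def Int_def conj_commute)
    finally show ?thesis
      using A x_meas
      by (simp add: emeasure_distr space_uniform_count_measure emeasure_uniform_count_measure
          ennreal_mult[symmetric])
  qed
  then have "empirical_measure M n x
      = measure_of (space M) (sets M) (emeasure (distr (uniform_count_measure {1..n}) M x))"
    unfolding empirical_measure_def
    by (intro measure_of_eq) (simp_all add: sets.space_closed sets.sigma_sets_eq)
  also have "\<dots> = distr (uniform_count_measure {1..n}) M x"
    using measure_of_of_measure[of "distr (uniform_count_measure {1..n}) M x"] by simp
  finally show ?thesis .
qed

lemma
  assumes n: "1 \<le> n" and x: "\<And>i. i \<in> {1..n} \<Longrightarrow> x i \<in> space M"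
  shows empirical_measure_in_prob_algebra: "empirical_measure M n x \<in> space (prob_algebra M)"
    and integral_empirical_measure:
      "\<And>f :: _ \<Rightarrow> real. f \<in> borel_measurable M \<Longrightarrow>
         (\<integral>y. f y \<partial>empirical_measure M n x) = (\<Sum>i=1..n. f (x i)) / real n"
proof -
  have x_meas: "x \<in> uniform_count_measure {1..n} \<rightarrow>\<^sub>M M"
    using x by (simp add: measurable_def sets_uniform_count_measure space_uniform_count_measure)
  have eq: "empirical_measure M n x = distr (uniform_count_measure {1..n}) M x"
    by (rule empirical_measure_eq_distr[OF x])
  have "prob_space (distr (uniform_count_measure {1..n}) M x)"
    using n by (intro prob_space.prob_space_distr prob_space_uniform_count_measure x_meas) auto
  then show "empirical_measure M n x \<in> space (prob_algebra M)"
    unfolding eq by (simp add: space_prob_algebra)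
  show "(\<integral>y. f y \<partial>empirical_measure M n x) = (\<Sum>i=1..n. f (x i)) / real n"
    if "f \<in> borel_measurable M" for f :: "_ \<Rightarrow> real"
    unfolding eq using that x_meas
    by (simp add: integral_distr integral_uniform_count_measure)
qed

lemma (in prob_space) indep_vars_imp_indep_var:
  assumes X: "indep_vars N X I" and ij: "i \<in> I" "j \<in> I" "i \<noteq> j"
  shows "indep_var (N i) (X i) (N j) (X j)"
proof -
  have "indep_var (N i) ((\<lambda>f. f i) \<circ> (\<lambda>\<omega>. restrict (\<lambda>i. X i \<omega>) {i}))
      (N j) ((\<lambda>f. f j) \<circ> (\<lambda>\<omega>. restrict (\<lambda>i. X i \<omega>) {j}))"
    using ij by (intro indep_var_compose[OF indep_var_restrict[OF X]]) auto
  then show ?thesis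
    by (simp add: comp_def)
qed

section \<open>Risk of the pseudo-posterior\<close>

context bounded_measurable_rkhs
begin

lemma mmd_sq_empirical:
  assumes n: "1 \<le> n" and x: "\<And>i. i \<in> {1..n} \<Longrightarrow> x i \<in> space M"
    and P0: "P0 \<in> space (prob_algebra M)"
  shows "(mmd_dist (empirical_measure M n x) P0)\<^sup>2
    = (\<Sum>i=1..n. \<Sum>j=1..n. k (x i) (x j)) / (real n)\<^sup>2 - 2 * (\<Sum>i=1..n. emb P0 (x i)) / real n
      + (\<integral>y. emb P0 y \<partial>P0)"
proof -
  let ?E = "empirical_measure M n x"
  have E: "?E \<in> space (prob_algebra M)"
    by (rule empirical_measure_in_prob_algebra[OF n x])
  have "emb ?E (x i) = (\<Sum>j=1..n. k (x i) (x j)) / real n" if i: "i \<in> {1..n}" for i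
  proof -
    have k_meas: "(\<lambda>y. k (x i) y) \<in> borel_measurable M"
      using measurable_Pair2[OF kernel_measurable x[OF i]] by simp
    show ?thesis
      unfolding mean_embedding_apply[OF E x[OF i]]
      by (rule integral_empirical_measure[OF n x k_meas])
  qed
  then have "(\<integral>y. emb ?E y \<partial>?E) = (\<Sum>i=1..n. (\<Sum>j=1..n. k (x i) (x j)) / real n) / real n"
    using integral_empirical_measure[OF n x member_measurable[OF mean_embedding_mem[OF E]]] by simp
  moreover have "(\<integral>y. emb P0 y \<partial>?E) = (\<Sum>i=1..n. emb P0 (x i)) / real n"
    by (rule integral_empirical_measure[OF n x member_measurable[OF mean_embedding_mem[OF P0]]])
  ultimately show ?thesis
    unfolding mmd_sq_eq_integrals[OF E P0]
    by (simp add: sum_divide_distrib[symmetric] power2_eq_square)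
qed

text \<open>
  The variance bound. With \<open>c = \<parallel>\<mu>(P0)\<parallel>\<^sup>2\<close>, the \<open>n\<^sup>2 - n\<close> off-diagonal terms of the double sum have
  expectation \<open>c\<close> by independence, and the \<open>n\<close> diagonal ones at most 1. As \<open>c \<ge> 0\<close>, the double sum has
  expectation at most \<open>n\<^sup>2 c + n\<close>; the cross terms cancel the part \<open>n\<^sup>2 c\<close>, and \<open>n / n\<^sup>2\<close> is left.
\<close>

lemma expected_mmd_sq_empirical_le:
  fixes X :: "nat \<Rightarrow> 'w \<Rightarrow> 'x" and n P0
  defines "D \<equiv> \<lambda>\<omega>. (mmd_dist (empirical_measure M n (\<lambda>i. X i \<omega>)) P0)\<^sup>2"
  assumes "prob_space \<Omega>" and indep: "prob_space.indep_vars \<Omega> (\<lambda>_. M) X {1..n}"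
    and X_distr: "\<And>i. i \<in> {1..n} \<Longrightarrow> distr \<Omega> M (X i) = P0"
    and P0: "P0 \<in> space (prob_algebra M)" and n: "1 \<le> n"
  shows mmd_sq_empirical_measurable: "D \<in> borel_measurable \<Omega>"
    and "(\<integral>\<^sup>+ \<omega>. ennreal (D \<omega>) \<partial>\<Omega>) \<le> ennreal (1 / real n)"
proof -
  interpret prob_space \<Omega> by fact
  have X_meas: "X i \<in> \<Omega> \<rightarrow>\<^sub>M M" if "i \<in> {1..n}" for i
    using indep that unfolding indep_vars_def2 by blast
  have X_space: "X i \<omega> \<in> space M" if "i \<in> {1..n}" "\<omega> \<in> space \<Omega>" for i \<omega>
    using measurable_space[OF X_meas] that by blast
  define c where "c = (\<integral>y. emb P0 y \<partial>P0)"
  have c_nonneg: "0 \<le> c"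
    using ip_nonneg[OF mean_embedding_mem[OF P0]] ip_mean_embedding[OF P0 mean_embedding_mem[OF P0]]
    by (simp add: c_def)
  have pair_meas: "(\<lambda>\<omega>. (X i \<omega>, X j \<omega>)) \<in> \<Omega> \<rightarrow>\<^sub>M M \<Otimes>\<^sub>M M" if "i \<in> {1..n}" "j \<in> {1..n}" for i j
    using X_meas that by measurable
  have k_int: "integrable \<Omega> (\<lambda>\<omega>. k (X i \<omega>) (X j \<omega>))" if ij: "i \<in> {1..n}" "j \<in> {1..n}" for i j
  proof (rule integrable_const_bound)
    show "AE \<omega> in \<Omega>. norm (k (X i \<omega>) (X j \<omega>)) \<le> 1"
      using kernel_bounded X_space ij by (intro AE_I2) auto
    show "(\<lambda>\<omega>. k (X i \<omega>) (X j \<omega>)) \<in> borel_measurable \<Omega>"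
      using measurable_compose[OF pair_meas[OF ij] kernel_measurable] by simp
  qed
  \<comment> \<open>on the diagonal \<open>c + 1\<close> instead of 1 is lossy but keeps the sum uniform\<close>
  have E_k: "expectation (\<lambda>\<omega>. k (X i \<omega>) (X j \<omega>)) \<le> c + (if i = j then 1 else 0)"
    if ij: "i \<in> {1..n}" "j \<in> {1..n}" for i j
  proof (cases "i = j")
    case True
    have "expectation (\<lambda>\<omega>. k (X i \<omega>) (X j \<omega>)) \<le> 1"
      using kernel_bounded X_space ij
      by (intro integral_le_const k_int[OF ij] AE_I2) (auto simp: abs_le_iff)
    then show ?thesis
      using True c_nonneg by simp
  next
    case False
    have "distr \<Omega> (M \<Otimes>\<^sub>M M) (\<lambda>\<omega>. (X i \<omega>, X j \<omega>)) = P0 \<Otimes>\<^sub>M P0"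
      using indep_vars_imp_indep_var[OF indep ij False] X_distr[OF ij(1)] X_distr[OF ij(2)]
      unfolding indep_var_distribution_eq by simp
    then have "expectation (\<lambda>\<omega>. k (X i \<omega>) (X j \<omega>)) = c"
      using integral_distr[OF pair_meas[OF ij] kernel_measurable] integral_mean_embedding[OF P0 P0]
      by (simp add: c_def)
    then show ?thesis
      using False by simp
  qed
  have g_meas: "emb P0 \<in> borel_measurable M"
    by (rule member_measurable[OF mean_embedding_mem[OF P0]])
  have g_int: "integrable \<Omega> (\<lambda>\<omega>. emb P0 (X i \<omega>))" and E_g: "expectation (\<lambda>\<omega>. emb P0 (X i \<omega>)) = c"
    if i: "i \<in> {1..n}" for i
    using integrable_distr_eq[OF X_meas[OF i] g_meas] integral_distr[OF X_meas[OF i] g_meas]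
      member_integrable[OF mean_embedding_mem[OF P0] P0] X_distr[OF i]
    by (simp_all add: c_def)
  define F where "F \<omega> = (\<Sum>i=1..n. \<Sum>j=1..n. k (X i \<omega>) (X j \<omega>)) / (real n)\<^sup>2
      - 2 * (\<Sum>i=1..n. emb P0 (X i \<omega>)) / real n + c" for \<omega>
  have D_eq: "D \<omega> = F \<omega>" if "\<omega> \<in> space \<Omega>" for \<omega>
    unfolding D_def F_def c_def using X_space[OF _ that] by (intro mmd_sq_empirical[OF n _ P0])
  have row_int: "integrable \<Omega> (\<lambda>\<omega>. \<Sum>j=1..n. k (X i \<omega>) (X j \<omega>))" if "i \<in> {1..n}" for i
    using that by (intro Bochner_Integration.integrable_sum k_int)
  have k_sum_int: "integrable \<Omega> (\<lambda>\<omega>. \<Sum>i=1..n. \<Sum>j=1..n. k (X i \<omega>) (X j \<omega>))"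
    by (intro Bochner_Integration.integrable_sum row_int)
  have g_sum_int: "integrable \<Omega> (\<lambda>\<omega>. \<Sum>i=1..n. emb P0 (X i \<omega>))"
    by (intro Bochner_Integration.integrable_sum g_int)
  have F_int: "integrable \<Omega> F"
    unfolding F_def using k_sum_int g_sum_int by simp
  show D_meas: "D \<in> borel_measurable \<Omega>"
    using borel_measurable_integrable[OF F_int] D_eq by (subst measurable_cong[where g = F])
  have "expectation (\<lambda>\<omega>. \<Sum>i=1..n. \<Sum>j=1..n. k (X i \<omega>) (X j \<omega>))
      = (\<Sum>i=1..n. expectation (\<lambda>\<omega>. \<Sum>j=1..n. k (X i \<omega>) (X j \<omega>)))"
    by (rule Bochner_Integration.integral_sum[OF row_int])
  also have "\<dots> = (\<Sum>i=1..n. \<Sum>j=1..n. expectation (\<lambda>\<omega>. k (X i \<omega>) (X j \<omega>)))"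
    by (intro sum.cong refl Bochner_Integration.integral_sum k_int)
  also have "\<dots> \<le> (\<Sum>i=1..n. \<Sum>j=1..n. c + (if i = j then 1 else 0))"
    by (intro sum_mono E_k)
  also have "\<dots> = (real n)\<^sup>2 * c + real n"
    by (simp add: sum.distrib power2_eq_square algebra_simps)
  finally have E_k_sum: "expectation (\<lambda>\<omega>. \<Sum>i=1..n. \<Sum>j=1..n. k (X i \<omega>) (X j \<omega>))
      \<le> (real n)\<^sup>2 * c + real n" .
  have "expectation (\<lambda>\<omega>. \<Sum>i=1..n. emb P0 (X i \<omega>)) = (\<Sum>i=1..n. expectation (\<lambda>\<omega>. emb P0 (X i \<omega>)))"
    by (rule Bochner_Integration.integral_sum[OF g_int])
  also have "\<dots> = (\<Sum>i=1..n. c)"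
    by (intro sum.cong refl E_g)
  finally have E_g_sum: "expectation (\<lambda>\<omega>. \<Sum>i=1..n. emb P0 (X i \<omega>)) = real n * c"
    by simp
  have "expectation F = expectation (\<lambda>\<omega>. \<Sum>i=1..n. \<Sum>j=1..n. k (X i \<omega>) (X j \<omega>)) / (real n)\<^sup>2
      - 2 * expectation (\<lambda>\<omega>. \<Sum>i=1..n. emb P0 (X i \<omega>)) / real n + c"
    unfolding F_def using k_sum_int g_sum_int by (simp add: prob_space)
  also have "\<dots> \<le> ((real n)\<^sup>2 * c + real n) / (real n)\<^sup>2 - 2 * (real n * c) / real n + c"
    unfolding E_g_sum by (intro add_right_mono diff_right_mono divide_right_mono E_k_sum) simp
  also have "\<dots> = 1 / real n"
    using n by (simp add: power2_eq_square field_simps)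
  finally have "expectation F \<le> 1 / real n" .
  moreover have "(\<integral>\<^sup>+ \<omega>. ennreal (D \<omega>) \<partial>\<Omega>) = ennreal (expectation F)"
  proof -
    have "AE \<omega> in \<Omega>. 0 \<le> F \<omega>"
      by (intro AE_I2) (simp add: D_eq[symmetric] D_def)
    then have "(\<integral>\<^sup>+ \<omega>. ennreal (F \<omega>) \<partial>\<Omega>) = ennreal (expectation F)"
      by (rule nn_integral_eq_integral[OF F_int])
    then show ?thesis
      by (simp add: D_eq cong: nn_integral_cong)
  qed
  ultimately show "(\<integral>\<^sup>+ \<omega>. ennreal (D \<omega>) \<partial>\<Omega>) \<le> ennreal (1 / real n)"
    by (simp add: ennreal_leI)
qed

text \<open>
  The bound for a fixed sample, where \<open>Q\<close> stands for its empirical measure. On the prior-mass ball the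
  empirical loss is at most \<open>4 D\<^sup>2(P \<theta>s, P0) + 4 / n + 2 D\<^sup>2(Q, P0)\<close> by two triangle inequalities, and
  the entropy term is at most \<open>1 / n\<close>. Passing from the loss at \<open>Q\<close> to the loss at \<open>P0\<close> doubles the sum
  and adds another \<open>2 D\<^sup>2(Q, P0)\<close>.
\<close>

lemma gibbs_mmd_risk_le:
  assumes P: "P \<in> T \<rightarrow>\<^sub>M prob_algebra M" and Q: "Q \<in> space (prob_algebra M)"
    and P0: "P0 \<in> space (prob_algebra M)" and \<theta>s: "\<theta>s \<in> space T"
    and "prob_space \<pi>" and sets_\<pi>: "sets \<pi> = sets T" and \<beta>: "0 < \<beta>" and n: "1 \<le> n"
    and mass: "measure \<pi> {\<theta> \<in> space T. mmd_dist (P \<theta>) (P \<theta>s) \<le> real n powr (- 1 / 2)}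
      \<ge> exp (- \<beta> / real n)"
  shows "(\<integral>\<^sup>+ \<theta>. ennreal ((mmd_dist (P \<theta>) P0)\<^sup>2)
      \<partial>gibbs_measure \<pi> \<beta> (\<lambda>\<theta>. (mmd_dist (P \<theta>) Q)\<^sup>2))
    \<le> ennreal (8 * (mmd_dist (P \<theta>s) P0)\<^sup>2 + 10 / real n + 6 * (mmd_dist Q P0)\<^sup>2)"
proof -
  define L where "L \<theta> = (mmd_dist (P \<theta>) Q)\<^sup>2" for \<theta>
  define B where "B = {\<theta> \<in> space T. mmd_dist (P \<theta>) (P \<theta>s) \<le> real n powr (- 1 / 2)}"
  define d where "d = (mmd_dist Q P0)\<^sup>2"
  define a where "a = 4 * (mmd_dist (P \<theta>s) P0)\<^sup>2 + 4 / real n + 2 * d"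
  have P_mem: "P \<theta> \<in> space (prob_algebra M)" if "\<theta> \<in> space T" for \<theta>
    using measurable_space[OF P that] .
  have "L \<in> borel_measurable T"
    unfolding L_def by (rule mmd_sq_measurable[OF P Q])
  then have L_meas: "L \<in> borel_measurable \<pi>"
    using measurable_cong_sets[OF sets_\<pi> refl] by blast
  have mass_B: "exp (- \<beta> * (1 / real n)) \<le> measure \<pi> B"
    using mass by (simp add: B_def)
  \<comment> \<open>non-measurable sets have measure 0 by convention, so positive mass entails measurability\<close>
  then have "measure \<pi> B \<noteq> 0"
    by (metis exp_gt_zero not_less)
  then have B: "B \<in> sets \<pi>"
    using measure_notin_sets by blast
  have L_le: "L \<theta> \<le> a" if \<theta>: "\<theta> \<in> B" for \<theta>
  proof -
    have \<theta>T: "\<theta> \<in> space T" and close: "mmd_dist (P \<theta>) (P \<theta>s) \<le> real n powr (- 1 / 2)"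
      using \<theta> by (auto simp: B_def)
    have "(mmd_dist (P \<theta>) (P \<theta>s))\<^sup>2 \<le> (real n powr (- 1 / 2))\<^sup>2"
      using close mmd_nonneg[OF P_mem[OF \<theta>T] P_mem[OF \<theta>s]] by (intro power_mono)
    also have "\<dots> = 1 / real n"
      using n by (simp add: power2_eq_square powr_add[symmetric] powr_minus_divide)
    finally have "(mmd_dist (P \<theta>) P0)\<^sup>2 \<le> 2 * (1 / real n) + 2 * (mmd_dist (P \<theta>s) P0)\<^sup>2"
      using mmd_sq_triangle[OF P_mem[OF \<theta>T] P_mem[OF \<theta>s] P0] by simp
    moreover have "L \<theta> \<le> 2 * (mmd_dist (P \<theta>) P0)\<^sup>2 + 2 * d"
      using mmd_sq_triangle[OF P_mem[OF \<theta>T] P0 Q] mmd_sq_commute[OF P0 Q]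
      by (simp add: L_def d_def)
    ultimately show ?thesis
      by (simp add: a_def)
  qed
  have a_nonneg: "0 \<le> a"
    by (simp add: a_def d_def)
  let ?G = "gibbs_measure \<pi> \<beta> L"
  note gibbs = gibbs_mean_loss_le[OF \<open>prob_space \<pi>\<close> L_meas _ \<beta> B L_le mass_B a_nonneg]
    prob_space_gibbs_measure[OF \<open>prob_space \<pi>\<close> L_meas _ \<beta> B L_le mass_B a_nonneg]
  interpret G: prob_space ?G
    by (rule gibbs) (simp_all add: L_def)
  have sets_G: "sets ?G = sets \<pi>"
    by (simp add: gibbs_measure_def)
  then have [measurable]: "L \<in> borel_measurable ?G"
    using L_meas measurable_cong_sets[OF sets_G refl] by blast
  have space_G: "space ?G = space T"
    using sets_eq_imp_space_eq[OF sets_G] sets_eq_imp_space_eq[OF sets_\<pi>] by simp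
  have "(\<integral>\<^sup>+ \<theta>. ennreal ((mmd_dist (P \<theta>) P0)\<^sup>2) \<partial>?G) \<le> (\<integral>\<^sup>+ \<theta>. 2 * ennreal (L \<theta>) + ennreal (2 * d) \<partial>?G)"
  proof (rule nn_integral_mono)
    fix \<theta> assume "\<theta> \<in> space ?G"
    then have "(mmd_dist (P \<theta>) P0)\<^sup>2 \<le> 2 * L \<theta> + 2 * d"
      using mmd_sq_triangle[OF P_mem Q P0] unfolding L_def d_def space_G by blast
    then have "ennreal ((mmd_dist (P \<theta>) P0)\<^sup>2) \<le> ennreal (2 * L \<theta> + 2 * d)"
      by (rule ennreal_leI)
    also have "\<dots> = 2 * ennreal (L \<theta>) + ennreal (2 * d)"
      by (simp add: L_def d_def ennreal_plus ennreal_mult)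
    finally show "ennreal ((mmd_dist (P \<theta>) P0)\<^sup>2) \<le> 2 * ennreal (L \<theta>) + ennreal (2 * d)" .
  qed
  also have "\<dots> = 2 * (\<integral>\<^sup>+ \<theta>. ennreal (L \<theta>) \<partial>?G) + ennreal (2 * d)"
    by (simp add: nn_integral_add nn_integral_cmult G.emeasure_space_1)
  also have "\<dots> \<le> 2 * ennreal (a + 1 / real n) + ennreal (2 * d)"
    by (intro add_right_mono mult_left_mono gibbs) (simp_all add: L_def)
  also have "2 * ennreal (a + 1 / real n) = ennreal (2 * (a + 1 / real n))"
    using a_nonneg by (subst ennreal_mult) simp_all
  also have "\<dots> + ennreal (2 * d) = ennreal (2 * (a + 1 / real n) + 2 * d)"
    using a_nonneg by (intro ennreal_plus[symmetric]) (simp_all add: d_def)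
  also have "2 * (a + 1 / real n) + 2 * d = 8 * (mmd_dist (P \<theta>s) P0)\<^sup>2 + 10 / real n + 6 * d"
    by (simp add: a_def)
  finally show ?thesis
    unfolding L_def d_def .
qed

end

theorem theorem1:
  fixes M :: "'x measure"
    and k :: "'x \<Rightarrow> 'x \<Rightarrow> real"
    and H :: "('x \<Rightarrow> real) set"
    and ip :: "('x \<Rightarrow> real) \<Rightarrow> ('x \<Rightarrow> real) \<Rightarrow> real"
    and T :: "'t measure"
    and P :: "'t \<Rightarrow> 'x measure"
    and P0 :: "'x measure"
    and \<Omega> :: "'w measure"
    and X :: "nat \<Rightarrow> 'w \<Rightarrow> 'x"
    and \<pi> :: "'t measure"
    and \<beta> :: real
    and n :: nat
    and \<theta>s :: 't
  assumes "(\<lambda>(x, y). k x y) \<in> borel_measurable (M \<Otimes>\<^sub>M M)"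
    and "pos_def_kernel (space M) k"
    and "\<And>x y. x \<in> space M \<Longrightarrow> y \<in> space M \<Longrightarrow> \<bar>k x y\<bar> \<le> 1"
    and "integrally_strictly_pos_def M k"
    and "rkhs (space M) k H ip"
    and "prob_space P0" and "sets P0 = sets M"
    and "P \<in> T \<rightarrow>\<^sub>M prob_algebra M"
    and "n \<ge> 1"
    and "prob_space \<Omega>"
    and "prob_space.indep_vars \<Omega> (\<lambda>_. M) X {1..n}"
    and "\<And>i. i \<in> {1..n} \<Longrightarrow> distr \<Omega> M (X i) = P0"
    and "prob_space \<pi>" and "sets \<pi> = sets T"
    and "\<beta> > 0"
    and "is_arg_min (\<lambda>\<theta>. mmd (space M) k H ip (P \<theta>) P0) (\<lambda>\<theta>. \<theta> \<in> space T) \<theta>s"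
    and "measure \<pi> {\<theta> \<in> space T. mmd (space M) k H ip (P \<theta>) (P \<theta>s) \<le> real n powr (- 1 / 2)}
           \<ge> exp (- \<beta> / real n)"
  shows "(\<integral>\<^sup>+ \<omega>. (\<integral>\<^sup>+ \<theta>. ennreal ((mmd (space M) k H ip (P \<theta>) P0)\<^sup>2)
              \<partial>mmd_posterior M k H ip P \<pi> \<beta> n (\<lambda>i. X i \<omega>)) \<partial>\<Omega>)
         \<le> ennreal (8 * (INF \<theta>\<in>space T. (mmd (space M) k H ip (P \<theta>) P0)\<^sup>2) + 16 / real n)"
proof -
  interpret \<Omega>: prob_space \<Omega> by fact
  interpret bounded_measurable_rkhs M k H ip
    using assms(1,3,5) by (intro bounded_measurable_rkhs.intro bounded_measurable_rkhs_axioms.intro)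
  have P0: "P0 \<in> space (prob_algebra M)"
    using assms(6,7) by (simp add: space_prob_algebra)
  have \<theta>s: "\<theta>s \<in> space T"
    using assms(16) by (simp add: is_arg_min_def)
  define D where "D \<omega> = (mmd_dist (empirical_measure M n (\<lambda>i. X i \<omega>)) P0)\<^sup>2" for \<omega>
  note E_D = expected_mmd_sq_empirical_le[OF assms(10-12) P0 assms(9), folded D_def]
  have [measurable]: "D \<in> borel_measurable \<Omega>"
    unfolding D_def by (rule mmd_sq_empirical_measurable[OF assms(10-12) P0 assms(9)])
  define m where "m = (mmd_dist (P \<theta>s) P0)\<^sup>2"
  have m_nonneg: "0 \<le> m"
    by (simp add: m_def)
  have "m \<le> (mmd_dist (P \<theta>) P0)\<^sup>2" if \<theta>: "\<theta> \<in> space T" for \<theta>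
  proof -
    have "mmd_dist (P \<theta>s) P0 \<le> mmd_dist (P \<theta>) P0"
      using assms(16) \<theta> by (auto simp: is_arg_min_def not_less)
    then show ?thesis
      unfolding m_def using mmd_nonneg[OF measurable_space[OF assms(8) \<theta>s] P0] by (rule power_mono)
  qed
  then have m_le: "m \<le> (INF \<theta>\<in>space T. (mmd_dist (P \<theta>) P0)\<^sup>2)"
    using \<theta>s by (intro cINF_greatest) auto
  have "(\<integral>\<^sup>+ \<omega>. (\<integral>\<^sup>+ \<theta>. ennreal ((mmd_dist (P \<theta>) P0)\<^sup>2)
              \<partial>mmd_posterior M k H ip P \<pi> \<beta> n (\<lambda>i. X i \<omega>)) \<partial>\<Omega>)
      \<le> (\<integral>\<^sup>+ \<omega>. ennreal (8 * m + 10 / real n) + 6 * ennreal (D \<omega>) \<partial>\<Omega>)"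
  proof (rule nn_integral_mono)
    fix \<omega> assume \<omega>: "\<omega> \<in> space \<Omega>"
    have "X i \<omega> \<in> space M" if "i \<in> {1..n}" for i
      using assms(11) that \<omega> unfolding \<Omega>.indep_vars_def2 by (auto dest: measurable_space)
    then have Q: "empirical_measure M n (\<lambda>i. X i \<omega>) \<in> space (prob_algebra M)"
      by (rule empirical_measure_in_prob_algebra[OF assms(9)])
    have "(\<integral>\<^sup>+ \<theta>. ennreal ((mmd_dist (P \<theta>) P0)\<^sup>2) \<partial>mmd_posterior M k H ip P \<pi> \<beta> n (\<lambda>i. X i \<omega>))
        \<le> ennreal (8 * m + 10 / real n + 6 * D \<omega>)"
      unfolding mmd_posterior_def m_def D_def
      by (rule gibbs_mmd_risk_le[OF assms(8) Q P0 \<theta>s assms(13-15,9,17)])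
    also have "\<dots> = ennreal (8 * m + 10 / real n) + 6 * ennreal (D \<omega>)"
      using m_nonneg by (subst ennreal_plus) (simp_all add: D_def ennreal_mult)
    finally show "(\<integral>\<^sup>+ \<theta>. ennreal ((mmd_dist (P \<theta>) P0)\<^sup>2) \<partial>mmd_posterior M k H ip P \<pi> \<beta> n (\<lambda>i. X i \<omega>))
        \<le> ennreal (8 * m + 10 / real n) + 6 * ennreal (D \<omega>)" .
  qed
  also have "\<dots> = ennreal (8 * m + 10 / real n) + 6 * (\<integral>\<^sup>+ \<omega>. ennreal (D \<omega>) \<partial>\<Omega>)"
    by (simp add: nn_integral_add nn_integral_cmult \<Omega>.emeasure_space_1)
  also have "\<dots> \<le> ennreal (8 * m + 10 / real n) + 6 * ennreal (1 / real n)"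
    by (intro add_left_mono mult_left_mono E_D) simp_all
  also have "6 * ennreal (1 / real n) = ennreal (6 * (1 / real n))"
    by (subst ennreal_mult) simp_all
  also have "ennreal (8 * m + 10 / real n) + \<dots> = ennreal (8 * m + 10 / real n + 6 * (1 / real n))"
    using m_nonneg by (intro ennreal_plus[symmetric]) simp_all
  also have "\<dots> \<le> ennreal (8 * (INF \<theta>\<in>space T. (mmd_dist (P \<theta>) P0)\<^sup>2) + 16 / real n)"
    using m_le by (intro ennreal_leI) simp
  finally show ?thesis .
qed

end
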